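(* Let $\ell$ and $k$ be integers such that $1 \le \ell < k$, and let $m_1,\ldots,m_k$ be even positive integers such that $m_1+\ldots+m_\ell = m_{\ell+1}+\ldots+m_k$. If $\mathrm{OP}^\ast(m_1,\ldots,m_\ell)$ and $\mathrm{OP}^\ast(m_{\ell+1},\ldots,m_k)$ both have solutions, then $\mathrm{OP}^\ast(m_1,\ldots,m_k)$ has a solution.
   Context: $K_n^\ast$ denotes the complete symmetric digraph of order $n$ (every ordered pair of distinct vertices is an arc; no loops). For integers $m_1,\ldots,m_k \ge 2$ with $n=m_1+\ldots+m_k$, the directed Oberwolfach problem $\mathrm{OP}^\ast(m_1,\ldots,m_k)$ asks for a decomposition of $K_n^\ast$ (a partition of its arc set) into spanning subdigraphs, each of which is a disjoint union of $k$ directed cycles of lengths $m_1,\ldots,m_k$; such a decomposition is a solution. A directed cycle of length 2 consists of two opposite arcs between two vertices. *)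

theory Defs
  imports "Graph_Theory.Graph_Theory" "HOL-Library.Disjoint_Sets"
begin

definition complete_sym_digraph :: "nat \<Rightarrow> nat pair_pre_digraph" where
  "complete_sym_digraph n =
     \<lparr>pverts = {..<n}, parcs = {(u, v). u < n \<and> v < n \<and> u \<noteq> v}\<rparr>"

lemma complete_digraph_complete_sym_digraph:
  "complete_digraph n (with_proj (complete_sym_digraph n))"
  by (auto simp: complete_digraph_pair_def complete_sym_digraph_def)

definition decomposition :: "'a pair_pre_digraph \<Rightarrow> 'a pair_pre_digraph set \<Rightarrow> bool" where
  "decomposition G \<D> \<longleftrightarrow>
     (\<forall>H\<in>\<D>. subgraph (with_proj H) (with_proj G)) \<and>
     disjoint_family_on parcs \<D> \<and>
     (\<Union>H\<in>\<D>. parcs H) = parcs G"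

text \<open>
  The predicate \<open>pre_digraph.cycle\<close> speaks of closed arc walks without repeated vertices
  inside a digraph. Here the digraph has to consist of the vertices and arcs of such a walk and
  nothing else. For \<open>m = 2\<close> it is a pair of opposite arcs.
\<close>

definition directed_cycle :: "nat \<Rightarrow> 'a pair_pre_digraph \<Rightarrow> bool" where
  "directed_cycle m C \<longleftrightarrow>
     (\<exists>p. pre_digraph.cycle (with_proj C) p \<and> length p = m \<and>
          parcs C = set p \<and> pverts C = fst ` set p)"

definition disjoint_union_of_cycles :: "nat list \<Rightarrow> 'a pair_pre_digraph \<Rightarrow> bool" where
  "disjoint_union_of_cycles ms F \<longleftrightarrow>
     (\<exists>C :: nat \<Rightarrow> 'a pair_pre_digraph.
        (\<forall>i<length ms. directed_cycle (ms ! i) (C i)) \<and>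
        disjoint_family_on (\<lambda>i. pverts (C i)) {..<length ms} \<and>
        pverts F = (\<Union>i<length ms. pverts (C i)) \<and>
        parcs F = (\<Union>i<length ms. parcs (C i)))"

definition OP_star_solution :: "nat list \<Rightarrow> nat pair_pre_digraph set \<Rightarrow> bool" where
  "OP_star_solution ms \<D> \<longleftrightarrow>
     decomposition (complete_sym_digraph (sum_list ms)) \<D> \<and>
     (\<forall>F\<in>\<D>. spanning (with_proj F) (with_proj (complete_sym_digraph (sum_list ms))) \<and>
            disjoint_union_of_cycles ms F)"

definition OP_star_solvable :: "nat list \<Rightarrow> bool" where
  "OP_star_solvable ms \<longleftrightarrow> (\<exists>\<D>. OP_star_solution ms \<D>)"

end

theory Submission
  imports Defs
begin

text \<open>
  Let \<open>s\<close> be the common sum, and split the \<open>2 * s\<close> vertices into halves \<open>X\<close> and \<open>Y\<close>.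
  A solution on \<open>s\<close> vertices has exactly \<open>s - 1\<close> factors, so the factors of a solution on \<open>X\<close>
  and of one on \<open>Y\<close> can be united in pairs; these use up all arcs inside the halves.
  The arcs between the halves are split directly. Identify both halves with the integers
  modulo \<open>s\<close> and fix a permutation \<open>\<pi>\<close> with cycle lengths \<open>m\<^sub>1 / 2, \<dots>, m\<^sub>k / 2\<close>. The \<open>j\<close>-th
  factor has the arcs from \<open>x \<in> X\<close> to \<open>x + j \<in> Y\<close> and from \<open>x + j \<in> Y\<close> to \<open>\<pi> x \<in> X\<close>. Two
  consecutive steps apply \<open>\<pi>\<close>, so its cycles have lengths \<open>m\<^sub>1, \<dots>, m\<^sub>k\<close>.
\<close>

section \<open>Cycles as vertex lists\<close>

text \<open>\<open>rotate1\<close> pairs each entry with its cyclic successor, including the closing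
  pair from last to first. A singleton gives a loop; this is needed because halving a length 2
  leaves a fixed point.\<close>

definition cycle_arcs :: "'a list \<Rightarrow> 'a rel" where
  "cycle_arcs c = set (zip c (rotate1 c))"

lemma pcas_iff: "pcas u p v \<longleftrightarrow> map fst p @ [v] = u # map snd p"
  by (induction p arbitrary: u) auto

lemma pcas_pawalk_verts: "pcas u p v \<Longrightarrow> pawalk_verts u p = u # map snd p"
  by (induction p arbitrary: u) auto

lemma pcas_closed_iff:
  assumes "p \<noteq> []"
  shows "pcas u p u \<longleftrightarrow> u = fst (hd p) \<and> map snd p = rotate1 (map fst p)"
  using assms by (cases p) (auto simp: pcas_iff)

text \<open>In a closed walk the heads are the tails rotated by one. So the start vertex is forced
  to be the first tail, and distinctness of the vertices after the first amounts to distinctness of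
  the tails.\<close>

lemma cycle_with_proj_iff:
  "pre_digraph.cycle (with_proj C) p \<longleftrightarrow>
     p \<noteq> [] \<and> fst (hd p) \<in> pverts C \<and> set p \<subseteq> parcs C \<and>
     map snd p = rotate1 (map fst p) \<and> distinct (map fst p)"
proof -
  have *: "pcas u p u \<and> distinct (tl (pawalk_verts u p)) \<longleftrightarrow>
      u = fst (hd p) \<and> map snd p = rotate1 (map fst p) \<and> distinct (map fst p)" if "p \<noteq> []" for u
  proof (cases "pcas u p u")
    case True
    then have "map snd p = rotate1 (map fst p)" "u = fst (hd p)"
      using pcas_closed_iff[OF that] by blast+
    moreover from this have "distinct (map snd p) \<longleftrightarrow> distinct (map fst p)"
      by (metis distinct1_rotate)
    ultimately show ?thesis
      using pcas_pawalk_verts[OF True] True by simp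
  next
    case False
    then show ?thesis
      using pcas_closed_iff[OF that] by blast
  qed
  have "pre_digraph.cycle (with_proj C) p \<longleftrightarrow>
      (\<exists>u. p \<noteq> [] \<and> u \<in> pverts C \<and> set p \<subseteq> parcs C \<and>
        (pcas u p u \<and> distinct (tl (pawalk_verts u p))))"
    unfolding pre_digraph.cycle_def pre_digraph.awalk_def cas_with_proj_eq
      awalk_verts_with_proj_eq with_proj_simps by blast
  then show ?thesis
    by (cases "p = []") (simp_all add: *)
qed

text \<open>The tails of the arc walk list its vertices; conversely, zipping a vertex list with its
  rotation recovers the walk.\<close>

lemma directed_cycle_iff:
  "directed_cycle m C \<longleftrightarrow>
     (\<exists>c. c \<noteq> [] \<and> distinct c \<and> length c = m \<and> pverts C = set c \<and> parcs C = cycle_arcs c)"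
proof
  assume "directed_cycle m C"
  then obtain p where p: "p \<noteq> []" "map snd p = rotate1 (map fst p)" "distinct (map fst p)"
      "length p = m" "parcs C = set p" "pverts C = fst ` set p"
    unfolding directed_cycle_def cycle_with_proj_iff by blast
  have "zip (map fst p) (map snd p) = p"
    by (simp add: zip_map_fst_snd)
  then have "parcs C = cycle_arcs (map fst p)"
    using p by (simp add: cycle_arcs_def)
  then show "\<exists>c. c \<noteq> [] \<and> distinct c \<and> length c = m \<and> pverts C = set c \<and> parcs C = cycle_arcs c"
    using p by (intro exI[of _ "map fst p"]) auto
next
  assume "\<exists>c. c \<noteq> [] \<and> distinct c \<and> length c = m \<and> pverts C = set c \<and> parcs C = cycle_arcs c"
  then obtain c where c: "c \<noteq> []" "distinct c" "length c = m" "pverts C = set c"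
      "parcs C = cycle_arcs c"
    by blast
  define p where "p = zip c (rotate1 c)"
  have p: "map fst p = c" "map snd p = rotate1 c" "length p = m" "p \<noteq> []" "parcs C = set p"
    using c by (auto simp: p_def cycle_arcs_def zip_eq_Nil_iff)
  have "fst ` set p = set c"
    using p(1) by (metis set_map)
  moreover have "fst (hd p) \<in> fst ` set p"
    using p(4) by simp
  ultimately show "directed_cycle m C"
    unfolding directed_cycle_def cycle_with_proj_iff
    using c p by (intro exI[of _ p]) auto
qed

text \<open>One condition, \<open>distinct (concat cs)\<close>, covers both that no cycle repeats a
  vertex and that the cycles are disjoint. Loops are allowed, so permutations with fixed points are
  included.\<close>

definition cycle_system :: "nat list \<Rightarrow> 'a set \<Rightarrow> 'a rel \<Rightarrow> bool" where
  "cycle_system ms V A \<longleftrightarrow>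
     (\<exists>cs. map length cs = ms \<and> [] \<notin> set cs \<and> distinct (concat cs) \<and>
        set (concat cs) = V \<and> (\<Union>c\<in>set cs. cycle_arcs c) = A)"

lemma disjoint_family_onI:
  "(\<And>i j. i \<in> I \<Longrightarrow> j \<in> I \<Longrightarrow> i \<noteq> j \<Longrightarrow> A i \<inter> A j = {}) \<Longrightarrow> disjoint_family_on A I"
  by (simp add: disjoint_family_on_def)

text \<open>Disjointness is indexed by position, to match the family in
  \<open>disjoint_union_of_cycles\<close>.\<close>

lemma distinct_concat_nth_iff:
  "distinct (concat cs) \<longleftrightarrow>
     (\<forall>i<length cs. distinct (cs ! i)) \<and> disjoint_family_on (\<lambda>i. set (cs ! i)) {..<length cs}"
proof (induction cs)
  case Nil
  then show ?case by (simp add: disjoint_family_on_def)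
next
  case (Cons c cs)
  have "disjoint_family_on (\<lambda>i. set ((c # cs) ! i)) {..<length (c # cs)} \<longleftrightarrow>
      set c \<inter> (\<Union>i<length cs. set (cs ! i)) = {} \<and>
      disjoint_family_on (\<lambda>i. set (cs ! i)) {..<length cs}"
    unfolding length_Cons lessThan_Suc_eq_insert_0
    by (subst disjoint_family_on_insert) (auto simp: disjoint_family_on_def)
  moreover have "(\<Union>i<length cs. set (cs ! i)) = set (concat cs)"
    by (metis image_image list.set_map map_nth set_concat set_upt lessThan_atLeast0)
  moreover have "(\<forall>i<length (c # cs). distinct ((c # cs) ! i)) \<longleftrightarrow>
      distinct c \<and> (\<forall>i<length cs. distinct (cs ! i))"
    by (auto simp: less_Suc_eq_0_disj)
  ultimately show ?case
    using Cons.IH by (auto simp del: set_concat)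
qed

lemma disjoint_union_of_cycles_iff:
  "disjoint_union_of_cycles ms F \<longleftrightarrow> cycle_system ms (pverts F) (parcs F)"
proof
  assume "disjoint_union_of_cycles ms F"
  then obtain C where C: "\<forall>i<length ms. directed_cycle (ms ! i) (C i)"
      "disjoint_family_on (\<lambda>i. pverts (C i)) {..<length ms}"
      "pverts F = (\<Union>i<length ms. pverts (C i))" "parcs F = (\<Union>i<length ms. parcs (C i))"
    unfolding disjoint_union_of_cycles_def by blast
  from C(1) obtain c where c: "\<And>i. i < length ms \<Longrightarrow> c i \<noteq> [] \<and> distinct (c i) \<and>
      length (c i) = ms ! i \<and> pverts (C i) = set (c i) \<and> parcs (C i) = cycle_arcs (c i)"
    unfolding directed_cycle_iff by metis
  define cs where "cs = map c [0..<length ms]"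
  have len: "length cs = length ms" and nth: "\<And>i. i < length ms \<Longrightarrow> cs ! i = c i"
    by (auto simp: cs_def)
  have "map length cs = ms"
    using c by (auto intro!: nth_equalityI simp: cs_def)
  moreover have "[] \<notin> set cs"
    using c by (force simp: cs_def)
  moreover have "distinct (concat cs)"
    using C(2) c by (auto simp: distinct_concat_nth_iff len nth disjoint_family_on_def)
  moreover have "set (concat cs) = pverts F"
    using C(3) c by (auto simp: cs_def)
  moreover have "(\<Union>c\<in>set cs. cycle_arcs c) = parcs F"
    using C(4) c by (auto simp: cs_def)
  ultimately show "cycle_system ms (pverts F) (parcs F)"
    unfolding cycle_system_def by blast
next
  assume "cycle_system ms (pverts F) (parcs F)"
  then obtain cs where cs: "map length cs = ms" "[] \<notin> set cs" "distinct (concat cs)"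
      "set (concat cs) = pverts F" "(\<Union>c\<in>set cs. cycle_arcs c) = parcs F"
    unfolding cycle_system_def by blast
  have len: "length cs = length ms"
    using cs(1) by auto
  have set_cs: "set cs = (!) cs ` {..<length ms}"
    using len by (auto simp: in_set_conv_nth)
  define C where "C i = \<lparr>pverts = set (cs ! i), parcs = cycle_arcs (cs ! i)\<rparr>" for i
  have "directed_cycle (ms ! i) (C i)" if "i < length ms" for i
    unfolding directed_cycle_iff
  proof (intro exI conjI)
    show "cs ! i \<noteq> []"
      using that cs(2) len by (metis nth_mem)
    show "distinct (cs ! i)"
      using that cs(3) len by (simp add: distinct_concat_nth_iff)
    show "length (cs ! i) = ms ! i"
      using that cs(1) len by (metis nth_map)
  qed (simp_all add: C_def)
  moreover have "disjoint_family_on (\<lambda>i. pverts (C i)) {..<length ms}"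
    using cs(3) len by (simp add: C_def distinct_concat_nth_iff)
  moreover have "pverts F = (\<Union>i<length ms. pverts (C i))"
    unfolding cs(4)[symmetric] set_concat set_cs by (simp add: C_def)
  moreover have "parcs F = (\<Union>i<length ms. parcs (C i))"
    unfolding cs(5)[symmetric] set_cs by (simp add: C_def)
  ultimately show "disjoint_union_of_cycles ms F"
    unfolding disjoint_union_of_cycles_def by blast
qed

section \<open>Cycle systems as permutations, and ways to build new ones\<close>

lemma zip_concat:
  assumes "map length xss = map length yss"
  shows "zip (concat xss) (concat yss) = concat (map2 zip xss yss)"
  using assms
proof (induction xss arbitrary: yss)
  case (Cons xs xss)
  then show ?case by (cases yss) auto
qed simp

text \<open>Tails and heads, each listed over all cycles, are two repetition-free enumerations of
  \<open>V\<close>, since rotation only reorders entries. Hence \<open>A\<close> is the graph of a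
  permutation of \<open>V\<close>.\<close>

lemma cycle_system_bijection:
  assumes "cycle_system ms V A"
  shows "single_valued A" "single_valued (A\<inverse>)" "Domain A = V" "Range A = V"
proof -
  obtain cs where cs: "distinct (concat cs)" "set (concat cs) = V"
      "(\<Union>c\<in>set cs. cycle_arcs c) = A"
    using assms unfolding cycle_system_def by blast
  define xs ys where "xs = concat cs" and "ys = concat (map rotate1 cs)"
  have "zip xs ys = concat (map2 zip cs (map rotate1 cs))"
    unfolding xs_def ys_def by (rule zip_concat) simp
  also have "\<dots> = concat (map (\<lambda>c. zip c (rotate1 c)) cs)"
    by (induction cs) auto
  finally have A: "A = set (zip xs ys)"
    using cs(3) by (simp add: cycle_arcs_def)
  have "mset ys = mset xs"
  proof -
    have "mset (rotate1 c) = mset c" for c :: "'a list"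
      by (cases c) auto
    then show ?thesis
      unfolding xs_def ys_def by (induction cs) auto
  qed
  moreover have xs: "distinct xs" "set xs = V"
    using cs by (simp_all add: xs_def)
  ultimately have ys: "length xs = length ys" "distinct ys" "set ys = V"
    by (metis mset_eq_length, metis mset_eq_imp_distinct_iff, metis mset_eq_setD)
  have "fst ` A = V" "snd ` A = V"
    unfolding A using xs(2) ys(1,3) by (metis list.set_map map_fst_zip, metis list.set_map map_snd_zip)
  then show "Domain A = V" "Range A = V"
    by (simp_all add: Domain_fst Range_snd)
  show "single_valued A" "single_valued (A\<inverse>)"
    unfolding A using xs(1) ys(1,2)
    by (auto simp: single_valued_def set_zip nth_eq_iff_index_eq)
qed

lemma cycle_system_append:
  assumes "cycle_system ms V A" "cycle_system ms' V' A'" "V \<inter> V' = {}"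
  shows "cycle_system (ms @ ms') (V \<union> V') (A \<union> A')"
proof -
  obtain cs where cs: "map length cs = ms" "[] \<notin> set cs" "distinct (concat cs)"
      "set (concat cs) = V" "(\<Union>c\<in>set cs. cycle_arcs c) = A"
    using assms(1) unfolding cycle_system_def by blast
  obtain cs' where cs': "map length cs' = ms'" "[] \<notin> set cs'" "distinct (concat cs')"
      "set (concat cs') = V'" "(\<Union>c\<in>set cs'. cycle_arcs c) = A'"
    using assms(2) unfolding cycle_system_def by blast
  show ?thesis
    unfolding cycle_system_def
    using cs cs' assms(3) by (intro exI[of _ "cs @ cs'"]) (auto simp del: set_concat)
qed

lemma cycle_system_image:
  assumes "cycle_system ms V A" "inj_on f V"
  shows "cycle_system ms (f ` V) (map_prod f f ` A)"
proof -
  obtain cs where cs: "map length cs = ms" "[] \<notin> set cs" "distinct (concat cs)"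
      "set (concat cs) = V" "(\<Union>c\<in>set cs. cycle_arcs c) = A"
    using assms(1) unfolding cycle_system_def by blast
  have arcs: "cycle_arcs (map f c) = map_prod f f ` cycle_arcs c" for c
    by (simp add: cycle_arcs_def rotate1_map zip_map_map map_prod_def)
  have "map length (map (map f) cs) = ms" "[] \<notin> set (map (map f) cs)"
    using cs by auto
  moreover have "distinct (concat (map (map f) cs))" "set (concat (map (map f) cs)) = f ` V"
    unfolding map_concat[symmetric] using cs assms(2)
    by (auto simp: distinct_map simp del: set_concat)
  moreover have "(\<Union>c\<in>set (map (map f) cs). cycle_arcs c) = map_prod f f ` A"
    using cs(5) by (auto simp: arcs)
  ultimately show ?thesis
    unfolding cycle_system_def by blast
qed

lemma cycle_system_exists:
  assumes "0 \<notin> set ms"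
  shows "\<exists>A. cycle_system ms {k..<k + sum_list ms} A"
  using assms
\<comment> \<open>Each length takes the next interval of integers as one cycle, so the starting
  point \<open>k\<close> moves along.\<close>
proof (induction ms arbitrary: k)
  case Nil
  then show ?case by (auto simp: cycle_system_def)
next
  case (Cons m ms)
  obtain A where A: "cycle_system ms {k + m..<k + m + sum_list ms} A"
    using Cons by auto
  have "cycle_system [m] {k..<k + m} (cycle_arcs [k..<k + m])"
    unfolding cycle_system_def using Cons.prems by (intro exI[of _ "[[k..<k + m]]"]) (auto simp: eq_commute[of "[]"])
  from cycle_system_append[OF this A]
  have "cycle_system (m # ms) ({k..<k + m} \<union> {k + m..<k + m + sum_list ms})
      (cycle_arcs [k..<k + m] \<union> A)"
    by auto
  moreover have "{k..<k + m} \<union> {k + m..<k + m + sum_list ms} = {k..<k + sum_list (m # ms)}"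
    by auto
  ultimately show ?case by auto
qed

section \<open>Doubling the lengths of the cycles\<close>

definition interleave :: "('a \<Rightarrow> 'a) \<Rightarrow> 'a list \<Rightarrow> 'a list" where
  "interleave t c = concat (map (\<lambda>x. [x, t x]) c)"

text \<open>Subdivision: an arc \<open>(x, y)\<close> of \<open>A\<close> becomes the path
  \<open>x\<close>, \<open>t x\<close>, \<open>y\<close>.\<close>

definition doubled_arcs :: "('a \<Rightarrow> 'a) \<Rightarrow> 'a set \<Rightarrow> 'a rel \<Rightarrow> 'a rel" where
  "doubled_arcs t V A = (\<lambda>x. (x, t x)) ` V \<union> map_prod t id ` A"

lemma interleave_simps [simp]:
  "interleave t [] = []"
  "interleave t (x # c) = x # t x # interleave t c"
  "interleave t (c @ d) = interleave t c @ interleave t d"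
  by (simp_all add: interleave_def)

lemma set_interleave: "set (interleave t c) = set c \<union> t ` set c"
  by (induction c) auto

lemma length_interleave: "length (interleave t c) = 2 * length c"
  by (induction c) auto

lemma interleave_eq_Nil_iff [simp]: "interleave t c = [] \<longleftrightarrow> c = []"
  by (cases c) auto

lemma interleave_concat: "interleave t (concat cs) = concat (map (interleave t) cs)"
  by (induction cs) auto

lemma distinct_interleave:
  assumes "distinct c" "inj_on t (set c)" "set c \<inter> t ` set c = {}"
  shows "distinct (interleave t c)"
  using assms by (induction c) (auto simp: set_interleave)

lemma cycle_arcs_interleave:
  "cycle_arcs (interleave t c) = doubled_arcs t (set c) (cycle_arcs c)"
proof (cases c)
  case Nil
  then show ?thesis by (simp add: cycle_arcs_def doubled_arcs_def)
next
  case (Cons x xs)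
  \<comment> \<open>The closing vertex is a free \<open>z\<close>, so that the induction runs over
    open paths; \<open>z = x\<close> then closes the cycle.\<close>
  have "set (zip (interleave t (x # xs)) (t x # interleave t xs @ [z])) =
      doubled_arcs t (set (x # xs)) (set (zip (x # xs) (xs @ [z])))" for z
    by (induction xs arbitrary: x) (auto simp: doubled_arcs_def)
  then show ?thesis
    by (simp add: Cons cycle_arcs_def)
qed

lemma cycle_system_doubled:
  assumes "cycle_system ms V A" "inj_on t V" "V \<inter> t ` V = {}"
  shows "cycle_system (map ((*) 2) ms) (V \<union> t ` V) (doubled_arcs t V A)"
proof -
  obtain cs where cs: "map length cs = ms" "[] \<notin> set cs" "distinct (concat cs)"
      "set (concat cs) = V" "(\<Union>c\<in>set cs. cycle_arcs c) = A"
    using assms(1) unfolding cycle_system_def by blast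
  let ?ds = "map (interleave t) cs"
  have "map length ?ds = map ((*) 2) ms"
    using cs(1) by (auto simp: length_interleave)
  moreover have "[] \<notin> set ?ds"
    using cs(2) unfolding list.set_map by (metis imageE interleave_eq_Nil_iff)
  moreover have "distinct (concat ?ds)" "set (concat ?ds) = V \<union> t ` V"
    unfolding interleave_concat[symmetric]
    using cs(3,4) assms(2,3) by (simp_all add: distinct_interleave set_interleave del: set_concat)
  moreover have "(\<Union>d\<in>set ?ds. cycle_arcs d) = doubled_arcs t V A"
    using cs(4,5) by (auto simp: cycle_arcs_interleave doubled_arcs_def)
  ultimately show ?thesis
    unfolding cycle_system_def by blast
qed

section \<open>Solutions as indexed families of arc sets\<close>

text \<open>The vertex set is arbitrary because the complete digraph on the second half is needed
  too.\<close>

definition offdiag :: "'a set \<Rightarrow> 'a rel" where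
  "offdiag V = V \<times> V - Id"

lemma parcs_complete_sym_digraph: "parcs (complete_sym_digraph n) = offdiag {..<n}"
  by (auto simp: complete_sym_digraph_def offdiag_def)

lemma pverts_complete_sym_digraph: "pverts (complete_sym_digraph n) = {..<n}"
  by (simp add: complete_sym_digraph_def)

lemma spanning_complete_sym_digraph:
  assumes "pverts F = {..<n}" "parcs F \<subseteq> offdiag {..<n}"
  shows "spanning (with_proj F) (with_proj (complete_sym_digraph n))"
proof -
  have "wf_digraph (with_proj F)" "wf_digraph (with_proj (complete_sym_digraph n))"
    using assms
    by (auto simp: wf_digraph_def parcs_complete_sym_digraph pverts_complete_sym_digraph offdiag_def)
  then show ?thesis
    using assms
    by (simp add: spanning_def subgraph_def compatible_def parcs_complete_sym_digraph
        pverts_complete_sym_digraph)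
qed

lemma OP_star_solvableI:
  assumes A: "\<And>i. i \<in> I \<Longrightarrow> cycle_system ms {..<sum_list ms} (A i)"
    and disj: "disjoint_family_on A I"
    and UN: "(\<Union>i\<in>I. A i) = offdiag {..<sum_list ms}"
  shows "OP_star_solvable ms"
proof -
  define F where "F i = \<lparr>pverts = {..<sum_list ms}, parcs = A i\<rparr>" for i
  have span: "spanning (with_proj (F i)) (with_proj (complete_sym_digraph (sum_list ms)))"
    if "i \<in> I" for i
    using that UN by (intro spanning_complete_sym_digraph) (auto simp: F_def)
  have "disjoint_family_on parcs (F ` I)"
  proof (rule disjoint_family_onI, clarify)
    fix i j assume "i \<in> I" "j \<in> I" "F i \<noteq> F j"
    \<comment> \<open>The definition asks for disjointness over the set of factors, not over
      indices.\<close>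
    moreover from this have "i \<noteq> j"
      by blast
    ultimately show "parcs (F i) \<inter> parcs (F j) = {}"
      using disj by (simp add: F_def disjoint_family_onD)
  qed
  moreover have "(\<Union>H\<in>F ` I. parcs H) = parcs (complete_sym_digraph (sum_list ms))"
    using UN by (simp add: F_def parcs_complete_sym_digraph)
  ultimately have "decomposition (complete_sym_digraph (sum_list ms)) (F ` I)"
    using span by (auto simp: decomposition_def spanning_def)
  moreover have "disjoint_union_of_cycles ms (F i)" if "i \<in> I" for i
    using A[OF that] by (simp add: disjoint_union_of_cycles_iff F_def)
  ultimately show ?thesis
    unfolding OP_star_solvable_def OP_star_solution_def using span by (intro exI[of _ "F ` I"]) auto
qed

text \<open>
  Each factor has exactly one arc leaving the vertex \<open>0\<close>; the factors are indexed by the head of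
  that arc.
\<close>

lemma OP_star_solvableE:
  assumes "OP_star_solvable ms" "0 < sum_list ms"
  obtains A where "\<And>i. i \<in> {1..<sum_list ms} \<Longrightarrow> cycle_system ms {..<sum_list ms} (A i)"
    "disjoint_family_on A {1..<sum_list ms}"
    "(\<Union>i\<in>{1..<sum_list ms}. A i) = offdiag {..<sum_list ms}"
proof -
  let ?n = "sum_list ms"
  obtain D where sol: "OP_star_solution ms D"
    using assms(1) by (auto simp: OP_star_solvable_def)
  then have D: "disjoint_family_on parcs D" "(\<Union>H\<in>D. parcs H) = offdiag {..<?n}"
    unfolding OP_star_solution_def decomposition_def parcs_complete_sym_digraph by blast+
  have sys: "cycle_system ms {..<?n} (parcs H)" if "H \<in> D" for H
    using sol that
    by (auto simp: OP_star_solution_def disjoint_union_of_cycles_iff spanning_def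
        pverts_complete_sym_digraph)
  have "\<exists>H\<in>D. (0, i) \<in> parcs H" if "i \<in> {1..<?n}" for i
  proof -
    have "(0, i) \<in> offdiag {..<?n}"
      using that by (auto simp: offdiag_def)
    then show ?thesis
      using D(2) by blast
  qed
  then obtain H where H: "\<And>i. i \<in> {1..<?n} \<Longrightarrow> H i \<in> D \<and> (0, i) \<in> parcs (H i)"
    by metis
  show thesis
  proof
    show "cycle_system ms {..<?n} (parcs (H i))" if "i \<in> {1..<?n}" for i
      using H sys that by blast
    show "disjoint_family_on (\<lambda>i. parcs (H i)) {1..<?n}"
    proof (rule disjoint_family_onI)
      fix i j assume ij: "i \<in> {1..<?n}" "j \<in> {1..<?n}" "i \<noteq> j"
      \<comment> \<open>A single factor cannot contain both \<open>(0, i)\<close> and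
        \<open>(0, j)\<close>, as its arc set is single-valued.\<close>
      have "H i \<noteq> H j"
        using H[OF ij(1)] H[OF ij(2)] ij(3) cycle_system_bijection(1)[OF sys, of "H i"]
        by (auto dest: single_valuedD)
      then show "parcs (H i) \<inter> parcs (H j) = {}"
        using D(1) H ij by (meson disjoint_family_onD)
    qed
    show "(\<Union>i\<in>{1..<?n}. parcs (H i)) = offdiag {..<?n}"
    proof
      show "(\<Union>i\<in>{1..<?n}. parcs (H i)) \<subseteq> offdiag {..<?n}"
        using D(2) H by blast
      show "offdiag {..<?n} \<subseteq> (\<Union>i\<in>{1..<?n}. parcs (H i))"
      proof
        fix e assume "e \<in> offdiag {..<?n}"
        then obtain G where G: "G \<in> D" "e \<in> parcs G"
          using D(2) by blast
        \<comment> \<open>No factor is missed by the indexing: each covers the vertex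
          \<open>0\<close>, which exists as the sum is positive.\<close>
        have "0 \<in> Domain (parcs G)"
          using cycle_system_bijection(3)[OF sys[OF G(1)]] assms(2) by simp
        then obtain i where i: "(0, i) \<in> parcs G"
          by blast
        then have "(0, i) \<in> offdiag {..<?n}"
          using D(2) G(1) by blast
        then have I: "i \<in> {1..<?n}"
          by (auto simp: offdiag_def)
        then have "H i = G"
          using H[OF I] disjoint_family_onD[OF D(1) _ G(1), of "H i"] i by blast
        then show "e \<in> (\<Union>i\<in>{1..<?n}. parcs (H i))"
          using G I by blast
      qed
    qed
  qed
qed

section \<open>Arcs between and inside the two halves\<close>

text \<open>Two residues below \<open>s\<close> differ by less than \<open>s\<close>, so a
  difference divisible by \<open>s\<close> vanishes.\<close>

lemma add_mod_left_inj:
  fixes x y j s :: nat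
  assumes "(x + j) mod s = (y + j) mod s" "x < s" "y < s"
  shows "x = y"
  using assms
proof (induction x y rule: linorder_wlog)
  case (le x y)
  then have "s dvd y - x"
    using mod_eq_dvd_iff_nat[of "x + j" "y + j" s] by simp
  then show ?case
    using le nat_dvd_not_less[of "y - x" s] by fastforce
qed simp

lemma add_mod_surj:
  fixes x y s :: nat
  assumes "x < s" "y < s"
  shows "\<exists>j<s. (x + j) mod s = y"
\<comment> \<open>The witness is \<open>y - x\<close> modulo \<open>s\<close>; adding
  \<open>s\<close> first avoids truncated subtraction.\<close>
proof (intro exI conjI)
  show "(s - x + y) mod s < s"
    using assms by simp
  show "(x + (s - x + y) mod s) mod s = y"
    using assms by (simp add: mod_add_right_eq)
qed

text \<open>Every arc between the halves determines its shift \<open>j\<close>. An arc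
  \<open>(x, y)\<close> upwards needs \<open>t j x = y\<close>; an arc \<open>(x, y)\<close>
  downwards needs \<open>t j z = x\<close>, where \<open>z\<close> is the unique predecessor of
  \<open>y\<close> under \<open>P\<close>.\<close>

lemma bipartite_cycle_decomposition:
  fixes s :: nat
  assumes "\<And>m. m \<in> set ms \<Longrightarrow> 0 < m \<and> even m" "sum_list ms = 2 * s"
  obtains A where "\<And>j. j < s \<Longrightarrow> cycle_system ms {..<2 * s} (A j)"
    "disjoint_family_on A {..<s}"
    "(\<Union>j<s. A j) = {..<s} \<times> {s..<2 * s} \<union> {s..<2 * s} \<times> {..<s}"
proof -
  define hs where "hs = map (\<lambda>m. m div 2) ms"
  have ms: "map ((*) 2) hs = ms"
    unfolding hs_def map_map by (rule map_idI) (use assms(1) in auto)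
  have "2 * sum_list hs = sum_list ms"
    using sum_list_const_mult[of 2 "\<lambda>h. h" hs] ms by simp
  then have "sum_list hs = s"
    using assms(2) by simp
  moreover have "0 \<notin> set hs"
    using assms(1) by (force simp: hs_def)
  ultimately obtain P where P: "cycle_system hs {..<s} P"
    using cycle_system_exists[of hs 0] by (auto simp: atLeast0LessThan)
  note bij = cycle_system_bijection[OF P]
  \<comment> \<open>Translation by \<open>j\<close> modulo \<open>s\<close>, landing in the copy
    \<open>{s..<2 * s}\<close> of the residues.\<close>
  define t where "t j x = s + (x + j) mod s" for j x :: nat
  have t_inj: "x = y" if "t j x = t j y" "x < s" "y < s" for j x y
    using that add_mod_left_inj[of x j s y] by (simp add: t_def)
  have t_inj': "i = j" if "t i x = t j x" "i < s" "j < s" for i j x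
    using that add_mod_left_inj[of i x s j] by (simp add: t_def add.commute)
  have t_surj: "\<exists>j<s. t j x = y" if xy: "x < s" "s \<le> y" "y < 2 * s" for x y
  proof -
    have "y - s < s"
      using xy by linarith
    then obtain j where "j < s" "(x + j) mod s = y - s"
      using add_mod_surj xy(1) by blast
    then show ?thesis
      using xy by (intro exI[of _ j]) (simp add: t_def)
  qed
  have t_range: "s \<le> t j x" "t j x < 2 * s" if "x < s" for j x
    using that by (auto simp: t_def)
  have P_less: "x < s" "y < s" if "(x, y) \<in> P" for x y
    using that bij(3,4) by auto
  define A where "A j = doubled_arcs (t j) {..<s} P" for j
  show thesis
  proof
    show "cycle_system ms {..<2 * s} (A j)" if "j < s" for j
    proof -
      have inj: "inj_on (t j) {..<s}"
        using t_inj by (auto intro!: inj_onI)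
      have "t j ` {..<s} \<subseteq> {s..<2 * s}"
        using t_range by auto
      \<comment> \<open>Equal finite cardinalities turn the inclusion into equality, so the doubled
        system spans both halves.\<close>
      moreover have "card (t j ` {..<s}) = card {s..<2 * s}"
        using inj by (simp add: card_image)
      ultimately have img: "t j ` {..<s} = {s..<2 * s}"
        by (intro card_subset_eq) auto
      have "{..<s} \<union> {s..<2 * s} = {..<2 * s}" "{..<s} \<inter> {s..<2 * s} = {}"
        by auto
      then show ?thesis
        using cycle_system_doubled[OF P inj] unfolding img A_def ms by simp
    qed
    show "disjoint_family_on A {..<s}"
    proof (rule disjoint_family_onI)
      fix i j assume ij: "i \<in> {..<s}" "j \<in> {..<s}" "i \<noteq> j"
      have False if e: "e \<in> A i" "e \<in> A j" for e
      proof (cases "fst e < s")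
        case True
        \<comment> \<open>The arcs coming from \<open>P\<close> start at some \<open>t k x\<close>,
          hence at or above \<open>s\<close>; only the matching part remains.\<close>
        then have "snd e = t k (fst e)" if "e \<in> A k" for k
          using that by (auto simp: A_def doubled_arcs_def t_def)
        then have "t i (fst e) = t j (fst e)"
          using e by metis
        then show False
          using t_inj'[of i "fst e" j] ij by auto
      next
        case False
        then obtain x y where "(x, snd e) \<in> P" "(y, snd e) \<in> P" "t i x = fst e" "t j y = fst e"
          using False e by (auto simp: A_def doubled_arcs_def)
        \<comment> \<open>\<open>P\<close> is injective, so both arcs pass through the same
          predecessor, and the shifts can be compared there.\<close>
        moreover from this have "x = y"
          using single_valuedD[OF bij(2)] by blast
        ultimately show False
          using t_inj'[of i y j] ij by auto
      qed
      then show "A i \<inter> A j = {}"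
        by blast
    qed
    show "(\<Union>j<s. A j) = {..<s} \<times> {s..<2 * s} \<union> {s..<2 * s} \<times> {..<s}" (is "?L = ?R")
    proof
      show "?L \<subseteq> ?R"
        using t_range P_less by (auto simp: A_def doubled_arcs_def)
      show "?R \<subseteq> ?L"
      proof (clarify, elim UnE SigmaE2)
        fix x y assume "x \<in> {..<s}" "y \<in> {s..<2 * s}"
        then show "(x, y) \<in> ?L"
          using t_surj[of x y] by (auto simp: A_def doubled_arcs_def)
      next
        fix x y assume xy: "x \<in> {s..<2 * s}" "y \<in> {..<s}"
        then obtain z where z: "(z, y) \<in> P"
          using bij(4) by blast
        then obtain j where "j < s" "t j z = x"
          using t_surj[of z x] P_less(1)[OF z] xy by auto
        then show "(x, y) \<in> ?L"
          using z by (force simp: A_def doubled_arcs_def)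
      qed
    qed
  qed
qed

text \<open>The \<open>s - 1\<close> paired factors \<open>E i\<close> use the arcs inside the
  halves and the \<open>s\<close> factors \<open>A j\<close> those between them,
  \<open>2 * s - 1\<close> factors in all.\<close>

lemma OP_star_solvable_append:
  assumes even: "\<And>m. m \<in> set (ms @ ms') \<Longrightarrow> 0 < m \<and> even m"
    and sums: "sum_list ms = s" "sum_list ms' = s"
    and solv: "OP_star_solvable ms" "OP_star_solvable ms'"
  shows "OP_star_solvable (ms @ ms')"
proof (cases "s = 0")
  case True
  \<comment> \<open>With no vertex \<open>0\<close> there is nothing to index factors by; but
    positive lengths with sum zero leave \<open>ms\<close> empty, and the claim is the one for
    \<open>ms'\<close>.\<close>
  then have "set ms = {}"
    using even sums by (metis set_append UnI1 equals0I less_irrefl sum_list_eq_0_iff)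
  then show ?thesis
    using solv by simp
next
  case False
  obtain B where B: "\<And>i. i \<in> {1..<s} \<Longrightarrow> cycle_system ms {..<s} (B i)"
      "disjoint_family_on B {1..<s}" "(\<Union>i\<in>{1..<s}. B i) = offdiag {..<s}"
    using OP_star_solvableE[OF solv(1)] sums False by auto
  obtain C where C: "\<And>i. i \<in> {1..<s} \<Longrightarrow> cycle_system ms' {..<s} (C i)"
      "disjoint_family_on C {1..<s}" "(\<Union>i\<in>{1..<s}. C i) = offdiag {..<s}"
    using OP_star_solvableE[OF solv(2)] sums False by auto
  obtain A where A: "\<And>j. j < s \<Longrightarrow> cycle_system (ms @ ms') {..<2 * s} (A j)"
      "disjoint_family_on A {..<s}"
      "(\<Union>j<s. A j) = {..<s} \<times> {s..<2 * s} \<union> {s..<2 * s} \<times> {..<s}"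
    using bipartite_cycle_decomposition[of "ms @ ms'" s] even sums by auto
  \<comment> \<open>Moves the arcs of the second solution from \<open>{..<s}\<close> to the upper
    half.\<close>
  define S where "S = map_prod ((+) s) ((+) s)"
  have S_inj: "inj S"
    by (auto simp: S_def intro!: prod.inj_map)
  define E where "E i = B i \<union> S ` C i" for i
  have shift: "(+) s ` {..<s} = {s..<2 * s}"
    using image_add_atLeastLessThan[of s 0 s] by (simp only: lessThan_atLeast0 add_0 mult_2)
  have S_offdiag: "S ` offdiag {..<s} = offdiag {s..<2 * s}"
  proof -
    have "S ` offdiag {..<s} = offdiag ((+) s ` {..<s})"
      by (force simp: S_def offdiag_def)
    then show ?thesis
      by (simp only: shift)
  qed
  have halves: "{..<s} \<union> {s..<2 * s} = {..<2 * s}" "{..<s} \<inter> {s..<2 * s} = {}"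
    by auto
  have E: "cycle_system (ms @ ms') {..<2 * s} (E i)" if "i \<in> {1..<s}" for i
    using cycle_system_append[OF B(1)[OF that] cycle_system_image[OF C(1)[OF that]], of "(+) s"]
      halves
    unfolding E_def S_def shift by simp
  have UN_E: "(\<Union>i\<in>{1..<s}. E i) = offdiag {..<s} \<union> offdiag {s..<2 * s}"
    unfolding E_def UN_Un_distrib B(3) image_UN[symmetric] C(3) S_offdiag ..
  have E_disj: "disjoint_family_on E {1..<s}"
  proof (rule disjoint_family_onI)
    fix i j assume ij: "i \<in> {1..<s}" "j \<in> {1..<s}" "i \<noteq> j"
    have B_sub: "B i' \<subseteq> offdiag {..<s}" and C_sub: "S ` C i' \<subseteq> offdiag {s..<2 * s}"
      if "i' \<in> {1..<s}" for i'
      using that B(3) C(3) S_offdiag by blast+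
    have "offdiag {..<s} \<inter> offdiag {s..<2 * s} = {}"
      by (auto simp: offdiag_def)
    then have "B i \<inter> S ` C j = {}" "S ` C i \<inter> B j = {}"
      using B_sub[OF ij(1)] B_sub[OF ij(2)] C_sub[OF ij(1)] C_sub[OF ij(2)] by blast+
    moreover have "B i \<inter> B j = {}"
      using disjoint_family_onD[OF B(2) ij] .
    moreover have "S ` C i \<inter> S ` C j = {}"
      using disjoint_family_onD[OF C(2) ij] image_Int[OF S_inj, of "C i" "C j"] by simp
    ultimately show "E i \<inter> E j = {}"
      unfolding E_def by (simp add: Int_Un_distrib Int_Un_distrib2)
  qed
  \<comment> \<open>A tagged sum is used because the two index ranges overlap.\<close>
  let ?I = "{1..<s} <+> {..<s}" and ?F = "case_sum E A"
  have n: "sum_list (ms @ ms') = 2 * s"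
    using sums by simp
  show ?thesis
  proof (rule OP_star_solvableI[of ?I _ ?F])
    show "cycle_system (ms @ ms') {..<sum_list (ms @ ms')} (?F i)" if "i \<in> ?I" for i
      unfolding n using that A(1) E by auto
    show "(\<Union>i\<in>?I. ?F i) = offdiag {..<sum_list (ms @ ms')}"
    proof -
      have "(\<Union>i\<in>?I. ?F i) = (\<Union>i\<in>{1..<s}. E i) \<union> (\<Union>j<s. A j)"
        by (auto simp: Plus_def)
      also have "\<dots> = offdiag {..<2 * s}"
        unfolding UN_E A(3) by (auto simp: offdiag_def)
      finally show ?thesis
        unfolding n .
    qed
    have EA: "E i \<inter> A j = {}" if "i \<in> {1..<s}" "j < s" for i j
    proof -
      have "E i \<subseteq> offdiag {..<s} \<union> offdiag {s..<2 * s}"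
        using UN_E that(1) by blast
      moreover have "A j \<subseteq> {..<s} \<times> {s..<2 * s} \<union> {s..<2 * s} \<times> {..<s}"
        using A(3) that(2) by blast
      moreover have "(offdiag {..<s} \<union> offdiag {s..<2 * s}) \<inter>
          ({..<s} \<times> {s..<2 * s} \<union> {s..<2 * s} \<times> {..<s}) = {}"
        by (auto simp: offdiag_def)
      ultimately show ?thesis by blast
    qed
    show "disjoint_family_on ?F ?I"
    proof (rule disjoint_family_onI)
      fix i j assume "i \<in> ?I" "j \<in> ?I" "i \<noteq> j"
      then show "?F i \<inter> ?F j = {}"
        using disjoint_family_onD[OF E_disj] disjoint_family_onD[OF A(2)] EA
        by (elim PlusE) (simp_all add: Int_commute[of "A _" "E _"])
    qed
  qed
qed

section \<open>Passage from length lists to the indexed lengths\<close>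

theorem theorem1p5:
  fixes l k :: nat and m :: "nat \<Rightarrow> nat"
  assumes "1 \<le> l" and "l < k"
    and "\<forall>i\<in>{1..k}. 0 < m i \<and> even (m i)"
    and "(\<Sum>i=1..l. m i) = (\<Sum>i=l+1..k. m i)"
    and "OP_star_solvable (map m [1..<l+1])"
    and "OP_star_solvable (map m [l+1..<k+1])"
  shows "OP_star_solvable (map m [1..<k+1])"
proof -
  \<comment> \<open>\<open>l < k\<close> ensures that \<open>l + 1 + (k - l)\<close> is
    \<open>k + 1\<close> in truncated arithmetic.\<close>
  have split: "[1..<k + 1] = [1..<l + 1] @ [l + 1..<k + 1]"
    using assms(1,2) upt_add_eq_append[of 1 "l + 1" "k - l"] by simp
  have sum: "sum_list (map m [a..<b + 1]) = (\<Sum>i=a..b. m i)" for a b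
    by (simp add: interv_sum_list_conv_sum_set_nat atLeastLessThanSuc_atLeastAtMost del: upt_Suc)
  show ?thesis
    unfolding split map_append
  proof (rule OP_star_solvable_append[where s = "\<Sum>i=1..l. m i"])
    show "0 < n \<and> even n" if "n \<in> set (map m [1..<l + 1] @ map m [l + 1..<k + 1])" for n
      using that assms(1-3) by auto
  qed (use assms(4-6) in \<open>simp_all only: sum\<close>)
qed

end
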